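(* Let $\alpha:R\to R'$ be a Jordan homomorphism and let $R''$ be the subring of $R'$ generated by $R^\alpha$. Then: (a) the mapping $\alpha_{PE}:PE_2(R)\to PE_2(R'')$, $H\cdot E(T)\mapsto H''\cdot E(T^\alpha)$ (for finite sequences $T$ in $R$) is a well defined homomorphism of groups; (b) the mapping $\overline\alpha:C\to C''$, $R(1,0)\cdot E(T)\mapsto R'(1',0')\cdot E(T^\alpha)$ (for finite sequences $T$ in $R$) is well defined; (c) $(\alpha_{PE},\overline\alpha)$ is a homomorphism of transformation groups, i.e. $(p\cdot E(T))^{\overline\alpha}=p^{\overline\alpha}\cdot E(T^\alpha)$ for all $p\in C$ and all finite sequences $T$ in $R$.
   Context: Rings are associative with $1$. A Jordan homomorphism $\alpha:R\to R'$ satisfies $(a+b)^\alpha=a^\alpha+b^\alpha$, $1^\alpha=1'$, $(aba)^\alpha=a^\alpha b^\alpha a^\alpha$. For $t$ in a ring, $E(t):=\begin{pmatrix} t&1\\-1&0\end{pmatrix}$; for $T=(t_1,\ldots,t_n)$, $E(T):=E(t_1)\cdots E(t_n)$ ($=I$ if $n=0$), $T^\alpha:=(t_1^\alpha,\ldots,t_n^\alpha)$. $E_2(R)\leq GL_2(R)$ is generated by all $E(t)$; $H$ is its centre, $PE_2(R):=E_2(R)/H$, and similarly $H''$, $PE_2(R'')$ for $R''$. The projective line $\mathbb{P}(R)$ is the set of submodules $R(a,b)\leq R^2$ with $(a,b)$ the first row of an invertible matrix, with right action $R(a,b)\cdot M=R((a,b)M)$ of $GL_2(R)$. Points $R(a,b),R(c,d)$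 are distant if $\{(a,b),(c,d)\}$ is a basis of $R^2$. $C$ is the connected component of $R(1,0)$ in the distant graph of $\mathbb{P}(R)$ (equal to the $E_2(R)$-orbit of $R(1,0)$). $\mathbb{P}(R'')$ is identified with a subset of $\mathbb{P}(R')$ via $R''(a,b)\mapsto R'(a,b)$, and $C''$ is the connected component of $R''(1',0')$ in $\mathbb{P}(R'')$ (the $E_2(R'')$-orbit of this point). $PE_2(R)$ and $PE_2(R'')$ act on $C$ and $C''$ respectively. *)

theory Defs
  imports "HOL-Algebra.Coset"
begin

definition jordan_hom :: "('a::ring_1 \<Rightarrow> 'b::ring_1) \<Rightarrow> bool" where
  "jordan_hom \<alpha> \<longleftrightarrow>
     (\<forall>a b. \<alpha> (a + b) = \<alpha> a + \<alpha> b) \<and> \<alpha> 1 = 1 \<and>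
     (\<forall>a b. \<alpha> (a * b * a) = \<alpha> a * \<alpha> b * \<alpha> a)"

inductive_set gen_subring :: "'b::ring_1 set \<Rightarrow> 'b set" for A where
  gen_base: "x \<in> A \<Longrightarrow> x \<in> gen_subring A"
| gen_one: "1 \<in> gen_subring A"
| gen_diff: "x \<in> gen_subring A \<Longrightarrow> y \<in> gen_subring A \<Longrightarrow> x - y \<in> gen_subring A"
| gen_mult: "x \<in> gen_subring A \<Longrightarrow> y \<in> gen_subring A \<Longrightarrow> x * y \<in> gen_subring A"

datatype 'a mat2 = M2 'a 'a 'a 'a  \<comment> \<open>M2 a b c d = [[a,b],[c,d]]\<close>

fun mmult :: "'a::ring_1 mat2 \<Rightarrow> 'a mat2 \<Rightarrow> 'a mat2" where
  "mmult (M2 a b c d) (M2 a' b' c' d') =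
     M2 (a*a' + b*c') (a*b' + b*d') (c*a' + d*c') (c*b' + d*d')"

definition mid :: "'a::ring_1 mat2" where
  "mid = M2 1 0 0 1"

definition Emat :: "'a::ring_1 \<Rightarrow> 'a mat2" where
  "Emat t = M2 t 1 (-1) 0"

definition Eseq :: "'a::ring_1 list \<Rightarrow> 'a mat2" where
  "Eseq T = foldr (\<lambda>t M. mmult (Emat t) M) T mid"

text \<open>E_2(S) for a subring S: the group generated by all E(t), t in S.
  (Since E(t)^{-1} = E(0)E(-t)E(0), this is the set of all products E(T).)\<close>
definition E2 :: "'a::ring_1 set \<Rightarrow> 'a mat2 set" where
  "E2 S = {Eseq T | T. set T \<subseteq> S}"

definition E2grp :: "'a::ring_1 set \<Rightarrow> 'a mat2 monoid" where
  "E2grp S = \<lparr>carrier = E2 S, mult = mmult, one = mid\<rparr>"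

definition centreE :: "'a::ring_1 set \<Rightarrow> 'a mat2 set" where
  "centreE S = {M \<in> E2 S. \<forall>N \<in> E2 S. mmult M N = mmult N M}"

definition PE2 :: "'a::ring_1 set \<Rightarrow> 'a mat2 set monoid" where
  "PE2 S = E2grp S Mod centreE S"

definition pt :: "'a::ring_1 \<times> 'a \<Rightarrow> ('a \<times> 'a) set" where
  "pt v = {(r * fst v, r * snd v) | r. True}"

fun vmult :: "'a::ring_1 \<times> 'a \<Rightarrow> 'a mat2 \<Rightarrow> 'a \<times> 'a" where
  "vmult (x, y) (M2 a b c d) = (x*a + y*c, x*b + y*d)"

definition act :: "('a::ring_1 \<times> 'a) set \<Rightarrow> 'a mat2 \<Rightarrow> ('a \<times> 'a) set" where
  "act p M = (\<lambda>v. vmult v M) ` p"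

text \<open>C (resp. C''): the E_2-orbit of R(1,0) (resp. R'(1',0') for a subring S of R').
  Points of P(R'') are identified with points of P(R'), so the submodules are
  taken over the whole ring type.\<close>
definition Corb :: "'a::ring_1 set \<Rightarrow> ('a \<times> 'a) set set" where
  "Corb S = {act (pt (1, 0)) (Eseq T) | T. set T \<subseteq> S}"

end

theory Submission
  imports Defs
begin

text \<open>
  Conjugation by \<open>E(T)\<close> preserves the Lie algebra of \<open>2 \<times> 2\<close> matrices generated by the matrices
  with zero diagonal and by \<open>diag(1, 0)\<close>, the Tits--Kantor--Koecher algebra of the Jordan ring \<open>R\<close>.
  Its diagonals involve products \<open>xy\<close>, which \<open>\<alpha>\<close> need not respect, so \<open>\<alpha>\<close> gives no evident map
  to the corresponding algebra over \<open>R'\<close>. It does give a relation, which is preserved when one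
  side is conjugated by \<open>E(T)\<close> and the other by \<open>E(T\<^sup>\<alpha>)\<close>, and along which off-diagonal entries
  transform by \<open>\<alpha>\<close>. Hence, if \<open>E(T)\<close> has rows \<open>(a, b)\<close>, \<open>(c, d)\<close> and \<open>E(T)\<^sup>-\<^sup>1\<close> has rows
  \<open>(p, q)\<close>, \<open>(r, s)\<close>, then \<open>\<alpha>\<close> maps \<open>axs\<close>, \<open>dxp\<close>, \<open>aq\<close>, \<open>cp\<close> to the corresponding expressions
  for \<open>T\<^sup>\<alpha>\<close>. If \<open>E(T)\<close> fixes \<open>R(1, 0)\<close>, that is \<open>b = q = 0\<close>, these force the same for \<open>T\<^sup>\<alpha>\<close>; if
  \<open>E(T)\<close> is central, hence a scalar matrix, they force \<open>E(T\<^sup>\<alpha>)\<close> to be scalar and to commute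
  with \<open>R\<^sup>\<alpha>\<close>.
\<close>

section \<open>The centre of a group\<close>

definition centre :: "('a, 'b) monoid_scheme \<Rightarrow> 'a set" where
  "centre G = {x \<in> carrier G. \<forall>y \<in> carrier G. x \<otimes>\<^bsub>G\<^esub> y = y \<otimes>\<^bsub>G\<^esub> x}"

lemma (in group) subgroup_centre: "subgroup (centre G) G"
proof (rule subgroupI)
  show "centre G \<subseteq> carrier G" "centre G \<noteq> {}"
    by (auto simp: centre_def)
next
  fix x assume x: "x \<in> centre G"
  have "inv x \<otimes> y = y \<otimes> inv x" if "y \<in> carrier G" for y
    using x that by (simp add: centre_def) (metis inv_closed inv_mult_group inv_inv)
  then show "inv x \<in> centre G"
    using x by (simp add: centre_def)
next
  fix x y assume "x \<in> centre G" "y \<in> centre G"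
  then have carrier: "x \<in> carrier G" "y \<in> carrier G"
    and commute: "\<And>z. z \<in> carrier G \<Longrightarrow> x \<otimes> z = z \<otimes> x" "\<And>z. z \<in> carrier G \<Longrightarrow> y \<otimes> z = z \<otimes> y"
    by (auto simp: centre_def)
  have "x \<otimes> y \<otimes> z = z \<otimes> (x \<otimes> y)" if z: "z \<in> carrier G" for z
  proof -
    have "x \<otimes> y \<otimes> z = x \<otimes> z \<otimes> y"
      by (simp only: m_assoc carrier z commute(2))
    also have "\<dots> = z \<otimes> (x \<otimes> y)"
      by (simp only: commute(1) m_assoc carrier z)
    finally show ?thesis .
  qed
  with carrier show "x \<otimes> y \<in> centre G"
    by (simp add: centre_def)
qed

lemma (in group) normal_centre: "centre G \<lhd> G"
proof -
  have "x \<otimes> z \<otimes> inv x = z" if "x \<in> carrier G" "z \<in> centre G" for x z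
  proof -
    have z: "z \<in> carrier G" and "x \<otimes> z = z \<otimes> x"
      using that by (auto simp: centre_def)
    with that show ?thesis
      by (simp add: m_assoc)
  qed
  then show ?thesis
    by (simp add: normal_inv_iff subgroup_centre)
qed

lemma (in normal) rcos_eq_iff:
  assumes "x \<in> carrier G" "y \<in> carrier G"
  shows "H #> x = H #> y \<longleftrightarrow> x \<otimes> inv y \<in> H"
proof -
  have "H #> x = H #> y \<longleftrightarrow> x \<in> H #> y"
    using assms repr_independence repr_independenceD subgroup_axioms by metis
  then show ?thesis
    using assms rcos_module is_group by simp
qed

section \<open>Words in elementary matrices\<close>

lemma mmult_assoc: "mmult (mmult A B) C = mmult A (mmult B C)"
  by (cases A; cases B; cases C) (simp add: algebra_simps)

lemma mmult_mid_left [simp]: "mmult mid A = A"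
  by (cases A) (simp add: mid_def)

lemma mmult_mid_right [simp]: "mmult A mid = A"
  by (cases A) (simp add: mid_def)

lemma inverse_mat2_lower_triangular:
  assumes right: "mmult (M2 a b c d) (M2 p q r s) = mid"
    and left: "mmult (M2 p q r s) (M2 a b c d) = mid"
    and units: "a * x = 1" "d * y = 1"
    and "a * q = 0"
  shows "b = 0" "q = 0"
proof -
  have "a * p * a = a * (p * a + q * c)"
    using \<open>a * q = 0\<close> by (simp add: distrib_left flip: mult.assoc)
  then have "a * p * a = a"
    using left by (simp add: mid_def)
  then have "a * p = 1"
    using units(1) by (metis mult.assoc mult_1_right)
  then have "b * r = 0" "b * s = 0"
    using right \<open>a * q = 0\<close> by (simp_all add: mid_def)
  then have "b * (r * b + s * d) = 0"
    by (simp add: distrib_left flip: mult.assoc)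
  then show "b = 0"
    using left by (simp add: mid_def)
  then have "q * d = 0"
    using left by (simp add: mid_def)
  then show "q = 0"
    using units(2) by (metis mult.assoc mult_1_right mult_zero_left)
qed

lemma Eseq_Nil [simp]: "Eseq [] = mid"
  by (simp add: Eseq_def)

lemma Eseq_Cons: "Eseq (t # T) = mmult (Emat t) (Eseq T)"
  by (simp add: Eseq_def)

lemma Eseq_append: "Eseq (S @ T) = mmult (Eseq S) (Eseq T)"
  by (induction S) (simp_all add: Eseq_Cons mmult_assoc)

primrec inverse_word :: "'a::ring_1 list \<Rightarrow> 'a list" where
  "inverse_word [] = []"
| "inverse_word (t # T) = inverse_word T @ [0, - t, 0]"

lemma Eseq_inverse_letter: "Eseq [0, - t, 0] = M2 0 (-1) 1 t"
  by (simp add: Eseq_Cons Emat_def mid_def)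

lemma Eseq_inverse_right: "mmult (Eseq T) (Eseq (inverse_word T)) = mid"
proof (induction T)
  case (Cons t T)
  have "mmult (Eseq (t # T)) (Eseq (inverse_word (t # T)))
      = mmult (Emat t) (mmult (mmult (Eseq T) (Eseq (inverse_word T))) (Eseq [0, - t, 0]))"
    by (simp only: inverse_word.simps Eseq_append Eseq_Cons[of t T] mmult_assoc)
  also have "\<dots> = mid"
    by (simp only: Cons.IH mmult_mid_left Eseq_inverse_letter) (simp add: Emat_def mid_def)
  finally show ?case .
qed simp

lemma Eseq_inverse_left: "mmult (Eseq (inverse_word T)) (Eseq T) = mid"
proof (induction T)
  case (Cons t T)
  have "mmult (Eseq (inverse_word (t # T))) (Eseq (t # T))
      = mmult (Eseq (inverse_word T)) (mmult (mmult (Eseq [0, - t, 0]) (Emat t)) (Eseq T))"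
    by (simp only: inverse_word.simps Eseq_append Eseq_Cons[of t T] mmult_assoc)
  also have "mmult (Eseq [0, - t, 0]) (Emat t) = mid"
    by (simp only: Eseq_inverse_letter) (simp add: Emat_def mid_def)
  finally show ?case
    by (simp add: Cons.IH)
qed simp

lemma Eseq_inverse_entries:
  assumes "Eseq T = M2 a b c d" "Eseq (inverse_word T) = M2 p q r s"
  shows "a * p + b * r = 1" "a * q + b * s = 0" "c * p + d * r = 0" "c * q + d * s = 1"
    "p * a + q * c = 1" "p * b + q * d = 0" "r * a + s * c = 0" "r * b + s * d = 1"
  using Eseq_inverse_right[of T] Eseq_inverse_left[of T] by (simp_all add: assms mid_def)

definition word_conj :: "'a::ring_1 list \<Rightarrow> 'a mat2 \<Rightarrow> 'a mat2" where
  "word_conj T X = mmult (mmult (Eseq T) X) (Eseq (inverse_word T))"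

lemma word_conj_Nil [simp]: "word_conj [] X = X"
  by (simp add: word_conj_def)

lemma word_conj_Cons: "word_conj (t # T) X = word_conj [t] (word_conj T X)"
  by (simp only: word_conj_def inverse_word.simps append_Nil Eseq_append Eseq_Cons[of t]
      Eseq_Nil mmult_mid_right mmult_assoc)

section \<open>The orbit of the base point\<close>

lemma act_mmult: "act (act p M) N = act p (mmult M N)"
proof -
  have "vmult (vmult v M) N = vmult v (mmult M N)" for v
    by (cases v; cases M; cases N) (simp add: algebra_simps)
  then show ?thesis
    by (simp add: act_def image_image)
qed

lemma act_mid [simp]: "act p mid = p"
proof -
  have "vmult v mid = v" for v :: "'a \<times> 'a"
    by (cases v) (simp add: mid_def)
  then show ?thesis
    by (simp add: act_def)
qed

lemma act_mono: "p \<subseteq> q \<Longrightarrow> act p M \<subseteq> act q M"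
  by (auto simp: act_def)

abbreviation Epoint :: "'a::ring_1 list \<Rightarrow> ('a \<times> 'a) set" where
  "Epoint T \<equiv> act (pt (1, 0)) (Eseq T)"

lemma act_Epoint: "act (Epoint S) (Eseq T) = Epoint (S @ T)"
  by (simp add: act_mmult Eseq_append)

lemma act_base: "act (pt (1, 0)) (M2 a b c d) = {(r * a, r * b) | r. True}"
  by (auto simp: act_def pt_def image_def)

lemma act_base_subset_base_iff: "act (pt (1, 0)) (M2 a b c d) \<subseteq> pt (1, 0) \<longleftrightarrow> b = 0"
proof
  have "(1 * a, 1 * b) \<in> act (pt (1, 0)) (M2 a b c d)"
    unfolding act_base by blast
  moreover assume "act (pt (1, 0)) (M2 a b c d) \<subseteq> pt (1, 0)"
  ultimately show "b = 0"
    by (auto simp: pt_def)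
next
  assume "b = 0"
  then show "act (pt (1, 0)) (M2 a b c d) \<subseteq> pt (1, 0)"
    unfolding act_base by (auto simp: pt_def)
qed

lemma Epoint_eq_base_iff:
  assumes "Eseq T = M2 a b c d" "Eseq (inverse_word T) = M2 p q r s"
  shows "Epoint T = pt (1, 0) \<longleftrightarrow> b = 0 \<and> q = 0"
proof -
  have "pt (1, 0) \<subseteq> Epoint T \<longleftrightarrow> Epoint (inverse_word T) \<subseteq> pt (1, 0)"
    using act_mono[of "pt (1, 0)" "Epoint T" "Eseq (inverse_word T)"]
      act_mono[of "Epoint (inverse_word T)" "pt (1, 0)" "Eseq T"]
    by (auto simp: act_mmult Eseq_inverse_left Eseq_inverse_right)
  moreover have "Epoint T \<subseteq> pt (1, 0) \<longleftrightarrow> b = 0" "Epoint (inverse_word T) \<subseteq> pt (1, 0) \<longleftrightarrow> q = 0"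
    unfolding assms by (rule act_base_subset_base_iff)+
  ultimately show ?thesis
    by blast
qed

lemma Epoint_eq_iff: "Epoint T = Epoint U \<longleftrightarrow> Epoint (T @ inverse_word U) = pt (1, 0)"
proof
  assume "Epoint T = Epoint U"
  then have "Epoint (T @ inverse_word U) = Epoint (U @ inverse_word U)"
    by (simp flip: act_Epoint)
  then show "Epoint (T @ inverse_word U) = pt (1, 0)"
    by (simp add: Eseq_append Eseq_inverse_right)
next
  assume "Epoint (T @ inverse_word U) = pt (1, 0)"
  then have "act (Epoint (T @ inverse_word U)) (Eseq U) = Epoint U"
    by simp
  then show "Epoint T = Epoint U"
    by (simp add: act_mmult Eseq_append mmult_assoc Eseq_inverse_left)
qed

section \<open>The elementary group and its central quotient\<close>

lemma Eseq_in_E2: "set T \<subseteq> S \<Longrightarrow> Eseq T \<in> E2 S"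
  by (auto simp: E2_def)

lemma mem_centreE_iff:
  assumes "0 \<in> S" "1 \<in> S"
  shows "M \<in> centreE S \<longleftrightarrow> M \<in> E2 S \<and> (\<exists>a. M = M2 a 0 0 a \<and> (\<forall>x \<in> S. a * x = x * a))"
proof
  assume central: "M \<in> centreE S"
  obtain a b c d where entries: "M = M2 a b c d"
    by (cases M)
  have Emat_commute: "mmult M (Emat t) = mmult (Emat t) M" if "t \<in> S" for t
    using central that Eseq_in_E2[of "[t]" S] by (auto simp: centreE_def Eseq_Cons)
  have commute: "a * t - b = t * a + c" "a = t * b + d" if "t \<in> S" for t
    using Emat_commute[OF that] unfolding entries Emat_def mmult.simps mat2.inject by auto
  have "d = a" "c = - b"
    using commute[OF assms(1)] by simp_all
  moreover have "b = 0"
    using commute(2)[OF assms(2)] \<open>d = a\<close> by simp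
  moreover from calculation have "a * x = x * a" if "x \<in> S" for x
    using commute(1)[OF that] by simp
  ultimately show "M \<in> E2 S \<and> (\<exists>a. M = M2 a 0 0 a \<and> (\<forall>x \<in> S. a * x = x * a))"
    using central by (simp add: centreE_def entries)
next
  assume "M \<in> E2 S \<and> (\<exists>a. M = M2 a 0 0 a \<and> (\<forall>x \<in> S. a * x = x * a))"
  then obtain a where mem: "M \<in> E2 S" and scalar: "M = M2 a 0 0 a"
    and commute: "\<And>x. x \<in> S \<Longrightarrow> a * x = x * a"
    by blast
  have "mmult M (Eseq T) = mmult (Eseq T) M" if "set T \<subseteq> S" for T
    using that
  proof (induction T)
    case (Cons t T)
    have "mmult M (Emat t) = mmult (Emat t) M"
      using commute Cons.prems by (simp add: scalar Emat_def)
    then show ?case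
      using Cons by (simp add: Eseq_Cons) (metis mmult_assoc)
  qed simp
  with mem show "M \<in> centreE S"
    by (auto simp: centreE_def E2_def)
qed

abbreviation Ecoset :: "'a::ring_1 set \<Rightarrow> 'a list \<Rightarrow> 'a mat2 set" where
  "Ecoset S T \<equiv> centreE S #>\<^bsub>E2grp S\<^esub> Eseq T"

lemma carrier_PE2: "carrier (PE2 S) = {Ecoset S T | T. set T \<subseteq> S}"
  by (auto simp: PE2_def carrier_FactGroup E2grp_def E2_def)

locale negation_closed =
  fixes S :: "'a::ring_1 set"
  assumes zero_mem: "0 \<in> S" and uminus_mem: "x \<in> S \<Longrightarrow> - x \<in> S"
begin

lemma set_inverse_word: "set T \<subseteq> S \<Longrightarrow> set (inverse_word T) \<subseteq> S"
  by (induction T) (auto simp: zero_mem uminus_mem)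

lemma group_E2grp: "group (E2grp S)"
proof (rule groupI)
  fix x y assume "x \<in> carrier (E2grp S)" "y \<in> carrier (E2grp S)"
  then obtain T U where "x = Eseq T" "set T \<subseteq> S" "y = Eseq U" "set U \<subseteq> S"
    by (auto simp: E2grp_def E2_def)
  then show "x \<otimes>\<^bsub>E2grp S\<^esub> y \<in> carrier (E2grp S)"
    using Eseq_in_E2[of "T @ U" S] by (simp add: E2grp_def Eseq_append)
next
  show "\<one>\<^bsub>E2grp S\<^esub> \<in> carrier (E2grp S)"
    using Eseq_in_E2[of "[]" S] by (simp add: E2grp_def)
next
  fix x assume "x \<in> carrier (E2grp S)"
  then obtain T where T: "x = Eseq T" "set T \<subseteq> S"
    by (auto simp: E2grp_def E2_def)
  then have "Eseq (inverse_word T) \<in> carrier (E2grp S)"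
    by (simp add: E2grp_def Eseq_in_E2 set_inverse_word)
  with T show "\<exists>y \<in> carrier (E2grp S). y \<otimes>\<^bsub>E2grp S\<^esub> x = \<one>\<^bsub>E2grp S\<^esub>"
    using Eseq_inverse_left[of T] by (auto simp: E2grp_def)
qed (simp_all add: E2grp_def mmult_assoc)

lemma normal_centreE: "centreE S \<lhd> E2grp S"
proof -
  have "centreE S = centre (E2grp S)"
    by (simp add: centreE_def centre_def E2grp_def)
  then show ?thesis
    using group.normal_centre[OF group_E2grp] by simp
qed

interpretation centre: normal "centreE S" "E2grp S"
  by (rule normal_centreE)

lemma Eseq_in_carrier: "set T \<subseteq> S \<Longrightarrow> Eseq T \<in> carrier (E2grp S)"
  by (simp add: E2grp_def Eseq_in_E2)

lemma inv_Eseq: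
  assumes "set T \<subseteq> S"
  shows "inv\<^bsub>E2grp S\<^esub> Eseq T = Eseq (inverse_word T)"
proof (rule centre.inv_equality)
  show "Eseq (inverse_word T) \<otimes>\<^bsub>E2grp S\<^esub> Eseq T = \<one>\<^bsub>E2grp S\<^esub>"
    by (simp add: E2grp_def Eseq_inverse_left)
qed (use assms in \<open>simp_all add: Eseq_in_carrier set_inverse_word\<close>)

lemma Ecoset_eq_iff:
  assumes "set T \<subseteq> S" "set U \<subseteq> S"
  shows "Ecoset S T = Ecoset S U \<longleftrightarrow> Eseq (T @ inverse_word U) \<in> centreE S"
proof -
  have "Ecoset S T = Ecoset S U \<longleftrightarrow> Eseq T \<otimes>\<^bsub>E2grp S\<^esub> inv\<^bsub>E2grp S\<^esub> Eseq U \<in> centreE S"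
    using assms by (intro centre.rcos_eq_iff Eseq_in_carrier)
  then show ?thesis
    by (simp only: inv_Eseq[OF assms(2)]) (simp add: E2grp_def Eseq_append)
qed

lemma mult_PE2:
  assumes "set T \<subseteq> S" "set U \<subseteq> S"
  shows "Ecoset S T \<otimes>\<^bsub>PE2 S\<^esub> Ecoset S U = Ecoset S (T @ U)"
proof -
  have "Ecoset S T \<otimes>\<^bsub>PE2 S\<^esub> Ecoset S U
      = centreE S #>\<^bsub>E2grp S\<^esub> (Eseq T \<otimes>\<^bsub>E2grp S\<^esub> Eseq U)"
    using centre.rcos_sum[OF assms[THEN Eseq_in_carrier]] by (simp add: PE2_def)
  then show ?thesis
    by (simp add: E2grp_def Eseq_append)
qed

end

interpretation UNIV: negation_closed UNIV
  by unfold_locales simp_all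

lemma zero_in_gen_subring: "0 \<in> gen_subring A"
  using gen_diff[OF gen_one gen_one] by simp

interpretation gen_subring: negation_closed "gen_subring A" for A
proof
  show "0 \<in> gen_subring A"
    by (rule zero_in_gen_subring)
  show "- x \<in> gen_subring A" if "x \<in> gen_subring A" for x
    using gen_diff[OF zero_in_gen_subring that] by simp
qed

lemma commutes_gen_subring:
  assumes "x \<in> gen_subring A" "\<And>y. y \<in> A \<Longrightarrow> a * y = y * a"
  shows "a * x = x * a"
  using assms(1)
proof (induction rule: gen_subring.induct)
  case (gen_mult x y)
  then show ?case
    by (metis mult.assoc)
qed (simp_all add: assms(2) algebra_simps)

lemma set_map_gen_subring: "set (map f T) \<subseteq> gen_subring (range f)"
  by (auto intro: gen_base)

section \<open>Matching the Tits--Kantor--Koecher algebras\<close>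

fun mdiff :: "'a::ring_1 mat2 \<Rightarrow> 'a mat2 \<Rightarrow> 'a mat2" where
  "mdiff (M2 a b c d) (M2 a' b' c' d') = M2 (a - a') (b - b') (c - c') (d - d')"

fun off_diagonal :: "'a mat2 \<Rightarrow> 'a \<times> 'a" where
  "off_diagonal (M2 a b c d) = (b, c)"

lemma word_conj_mdiff: "word_conj T (mdiff X Y) = mdiff (word_conj T X) (word_conj T Y)"
  unfolding word_conj_def
  by (cases X; cases Y; cases "Eseq T"; cases "Eseq (inverse_word T)") (simp add: algebra_simps)

lemma word_conj_letter_generators:
  "word_conj [t] (M2 0 x 0 0)
    = mdiff (mdiff (M2 (t * x) 0 0 (- (x * t))) (M2 0 (- (t * x * t)) 0 0)) (M2 0 0 x 0)"
  "word_conj [t] (M2 0 0 x 0) = M2 0 (- x) 0 0"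
  "word_conj [t] (M2 (x * y) 0 0 (- (y * x)))
    = mdiff (M2 0 (- (t * x * y + y * x * t)) 0 0) (M2 (y * x) 0 0 (- (x * y)))"
  "word_conj [t] (M2 1 0 0 0) = mdiff (M2 0 (- t) 0 0) (mdiff (M2 1 0 0 (- 1)) (M2 1 0 0 0))"
  by (simp_all add: word_conj_def Eseq_Cons Emat_def mid_def algebra_simps)

lemma off_diagonal_word_conj:
  assumes "Eseq T = M2 a b c d" "Eseq (inverse_word T) = M2 p q r s"
  shows "off_diagonal (word_conj T (M2 0 x 0 0)) = (a * x * s, c * x * r)"
    "off_diagonal (word_conj T (M2 0 0 x 0)) = (b * x * q, d * x * p)"
    "off_diagonal (word_conj T (M2 1 0 0 0)) = (a * q, c * p)"
  by (simp_all add: word_conj_def assms)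

inductive tkk_related :: "('a::ring_1 \<Rightarrow> 'b::ring_1) \<Rightarrow> 'a mat2 \<Rightarrow> 'b mat2 \<Rightarrow> bool"
  for \<alpha> where
  upper: "tkk_related \<alpha> (M2 0 x 0 0) (M2 0 (\<alpha> x) 0 0)"
| lower: "tkk_related \<alpha> (M2 0 0 x 0) (M2 0 0 (\<alpha> x) 0)"
| bracket: "tkk_related \<alpha> (M2 (x * y) 0 0 (- (y * x))) (M2 (\<alpha> x * \<alpha> y) 0 0 (- (\<alpha> y * \<alpha> x)))"
| grading: "tkk_related \<alpha> (M2 1 0 0 0) (M2 1 0 0 0)"
| diff: "tkk_related \<alpha> X X' \<Longrightarrow> tkk_related \<alpha> Y Y' \<Longrightarrow> tkk_related \<alpha> (mdiff X Y) (mdiff X' Y')"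

context
  fixes \<alpha> :: "'a::ring_1 \<Rightarrow> 'b::ring_1"
  assumes jordan: "jordan_hom \<alpha>"
begin

lemma jordan_add: "\<alpha> (x + y) = \<alpha> x + \<alpha> y"
  using jordan by (simp add: jordan_hom_def)

lemma jordan_one: "\<alpha> 1 = 1"
  using jordan by (simp add: jordan_hom_def)

lemma jordan_sandwich: "\<alpha> (x * y * x) = \<alpha> x * \<alpha> y * \<alpha> x"
  using jordan by (simp add: jordan_hom_def)

lemma jordan_zero: "\<alpha> 0 = 0"
  using jordan_add[of 0 0] by simp

lemma jordan_uminus: "\<alpha> (- x) = - \<alpha> x"
  using jordan_add[of x "- x"] by (simp add: jordan_zero eq_neg_iff_add_eq_0 add.commute)

lemma jordan_diff: "\<alpha> (x - y) = \<alpha> x - \<alpha> y"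
  using jordan_add[of x "- y"] by (simp add: jordan_uminus)

lemma jordan_triple: "\<alpha> (x * y * z + z * y * x) = \<alpha> x * \<alpha> y * \<alpha> z + \<alpha> z * \<alpha> y * \<alpha> x"
proof -
  have "x * y * z + z * y * x = (x + z) * y * (x + z) - x * y * x - z * y * z"
    by (simp add: algebra_simps)
  then have "\<alpha> (x * y * z + z * y * x) = \<alpha> ((x + z) * y * (x + z) - x * y * x - z * y * z)"
    by simp
  also have "\<dots> = \<alpha> x * \<alpha> y * \<alpha> z + \<alpha> z * \<alpha> y * \<alpha> x"
    unfolding jordan_diff jordan_sandwich jordan_add by (simp add: algebra_simps)
  finally show ?thesis .
qed

lemma map_inverse_word: "map \<alpha> (inverse_word T) = inverse_word (map \<alpha> T)"
  by (induction T) (simp_all add: jordan_zero jordan_uminus)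

lemma tkk_related_off_diagonal:
  "tkk_related \<alpha> X X' \<Longrightarrow> off_diagonal X' = map_prod \<alpha> \<alpha> (off_diagonal X)"
proof (induction rule: tkk_related.induct)
  case (diff X X' Y Y')
  then show ?case
    by (cases X; cases X'; cases Y; cases Y') (simp add: jordan_diff)
qed (simp_all add: jordan_zero)

lemma tkk_related_conj_letter:
  "tkk_related \<alpha> X X' \<Longrightarrow> tkk_related \<alpha> (word_conj [t] X) (word_conj [\<alpha> t] X')"
proof (induction rule: tkk_related.induct)
  case (upper x)
  have "tkk_related \<alpha> (M2 0 (- (t * x * t)) 0 0) (M2 0 (- (\<alpha> t * \<alpha> x * \<alpha> t)) 0 0)"
    using tkk_related.upper[of \<alpha> "- (t * x * t)"] by (simp only: jordan_uminus jordan_sandwich)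
  then show ?case
    unfolding word_conj_letter_generators by (intro tkk_related.intros)
next
  case (lower x)
  show ?case
    using tkk_related.upper[of \<alpha> "- x"] by (simp only: word_conj_letter_generators jordan_uminus)
next
  case (bracket x y)
  have "tkk_related \<alpha> (M2 0 (- (t * x * y + y * x * t)) 0 0)
      (M2 0 (- (\<alpha> t * \<alpha> x * \<alpha> y + \<alpha> y * \<alpha> x * \<alpha> t)) 0 0)"
    using upper[of \<alpha> "- (t * x * y + y * x * t)"] by (simp only: jordan_uminus jordan_triple)
  then show ?case
    unfolding word_conj_letter_generators by (intro tkk_related.intros)
next
  case grading
  have "tkk_related \<alpha> (M2 0 (- t) 0 0) (M2 0 (- \<alpha> t) 0 0)"
    using upper[of \<alpha> "- t"] by (simp only: jordan_uminus)
  moreover have "tkk_related \<alpha> (M2 1 0 0 (- 1)) (M2 1 0 0 (- 1))"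
    using bracket[of \<alpha> 1 1] by (simp add: jordan_one)
  ultimately show ?case
    unfolding word_conj_letter_generators by (intro diff tkk_related.grading)
next
  case (diff X X' Y Y')
  then show ?case
    unfolding word_conj_mdiff by (intro tkk_related.diff)
qed

lemma tkk_related_word_conj:
  "tkk_related \<alpha> X X' \<Longrightarrow> tkk_related \<alpha> (word_conj T X) (word_conj (map \<alpha> T) X')"
proof (induction T)
  case (Cons t T)
  then show ?case
    unfolding list.map word_conj_Cons[of _ "_ T"] word_conj_Cons[of t T]
    by (intro tkk_related_conj_letter)
qed simp

lemma jordan_word_entries:
  assumes "Eseq T = M2 a b c d" "Eseq (inverse_word T) = M2 p q r s"
    and "Eseq (map \<alpha> T) = M2 a' b' c' d'" "Eseq (inverse_word (map \<alpha> T)) = M2 p' q' r' s'"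
  shows "\<alpha> (a * x * s) = a' * \<alpha> x * s'" "\<alpha> (d * x * p) = d' * \<alpha> x * p'"
    "\<alpha> (a * q) = a' * q'" "\<alpha> (c * p) = c' * p'"
proof -
  note off_diagonal_transfer = tkk_related_off_diagonal[OF tkk_related_word_conj, of _ _ T]
  show "\<alpha> (a * x * s) = a' * \<alpha> x * s'"
    using off_diagonal_transfer[OF upper, of x] by (simp add: off_diagonal_word_conj assms)
  show "\<alpha> (d * x * p) = d' * \<alpha> x * p'"
    using off_diagonal_transfer[OF lower, of x] by (simp add: off_diagonal_word_conj assms)
  show "\<alpha> (a * q) = a' * q'" "\<alpha> (c * p) = c' * p'"
    using off_diagonal_transfer[OF grading] by (simp_all add: off_diagonal_word_conj assms)
qed

section \<open>The induced maps\<close>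

lemma jordan_lower_triangular:
  assumes entries: "Eseq T = M2 a b c d" "Eseq (inverse_word T) = M2 p q r s"
    and entries': "Eseq (map \<alpha> T) = M2 a' b' c' d'" "Eseq (inverse_word (map \<alpha> T)) = M2 p' q' r' s'"
    and zero: "b = 0" "q = 0"
  shows "b' = 0" "q' = 0"
proof -
  note transfer = jordan_word_entries[OF entries entries']
  have "a * (p * d) * s = 1" "d * (s * a) * p = 1"
    using Eseq_inverse_entries[OF entries] by (simp_all add: zero flip: mult.assoc)
  then have units': "a' * (\<alpha> (p * d) * s') = 1" "d' * (\<alpha> (s * a) * p') = 1"
    using transfer(1)[of "p * d"] transfer(2)[of "s * a"] by (simp_all add: jordan_one mult.assoc)
  have "a' * q' = 0"
    using transfer(3) by (simp add: zero jordan_zero)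
  with units' show "b' = 0" "q' = 0"
    using inverse_mat2_lower_triangular[of a' b' c' d' p' q' r' s']
      Eseq_inverse_right[of "map \<alpha> T"] Eseq_inverse_left[of "map \<alpha> T"]
    unfolding entries' by blast+
qed

lemma jordan_fixes_base:
  assumes "Epoint T = pt (1, 0)"
  shows "Epoint (map \<alpha> T) = pt (1, 0)"
proof -
  obtain a b c d p q r s where entries: "Eseq T = M2 a b c d" "Eseq (inverse_word T) = M2 p q r s"
    by (metis mat2.exhaust)
  obtain a' b' c' d' p' q' r' s' where entries': "Eseq (map \<alpha> T) = M2 a' b' c' d'"
    "Eseq (inverse_word (map \<alpha> T)) = M2 p' q' r' s'"
    by (metis mat2.exhaust)
  have "b = 0" "q = 0"
    using assms Epoint_eq_base_iff[OF entries] by simp_all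
  then have "b' = 0" "q' = 0"
    by (rule jordan_lower_triangular[OF entries entries'])+
  then show ?thesis
    using Epoint_eq_base_iff[OF entries'] by simp
qed

lemma jordan_maps_centreE:
  assumes "Eseq T \<in> centreE UNIV"
  shows "Eseq (map \<alpha> T) \<in> centreE (gen_subring (range \<alpha>))"
proof -
  obtain a where scalar: "Eseq T = M2 a 0 0 a" and commute: "\<And>x. a * x = x * a"
    using assms by (auto simp: mem_centreE_iff)
  obtain p q r s where inverse: "Eseq (inverse_word T) = M2 p q r s"
    by (cases "Eseq (inverse_word T)")
  obtain a' b' c' d' p' q' r' s' where entries': "Eseq (map \<alpha> T) = M2 a' b' c' d'"
    "Eseq (inverse_word (map \<alpha> T)) = M2 p' q' r' s'"
    by (metis mat2.exhaust)
  note identities = Eseq_inverse_entries[OF scalar inverse]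
    and identities' = Eseq_inverse_entries[OF entries']
  note transfer = jordan_word_entries[OF scalar inverse entries']
  have "q = 0"
    using identities by (metis add_0_right mult.assoc mult_1 mult_zero_left mult_zero_right)
  then have "b' = 0" "q' = 0"
    by (rule jordan_lower_triangular[OF scalar inverse entries' refl])+
  then have units': "p' * a' = 1" "s' * d' = 1"
    using identities' by simp_all
  have "c' = 0"
    using transfer(4) units'(1)
    by (simp add: jordan_zero) (metis mult.assoc mult_1_right mult_zero_left)
  have twisted: "a' * \<alpha> x = \<alpha> x * d'" for x
  proof -
    have "a * x * s = x"
      using identities(4) by (simp add: commute mult.assoc)
    then have "\<alpha> x * d' = a' * \<alpha> x * s' * d'"
      using transfer(1)[of x] by simp
    then show ?thesis
      using units'(2) by (simp add: mult.assoc)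
  qed
  have "d' = a'"
    using twisted[of 1] by (simp add: jordan_one)
  then have "\<forall>x \<in> gen_subring (range \<alpha>). a' * x = x * a'"
    using twisted by (auto intro: commutes_gen_subring)
  then show ?thesis
    using Eseq_in_E2[OF set_map_gen_subring, of \<alpha> T] entries'(1) \<open>b' = 0\<close> \<open>c' = 0\<close> \<open>d' = a'\<close>
    by (auto simp: mem_centreE_iff gen_one zero_in_gen_subring)
qed

lemma jordan_Ecoset_eq:
  assumes "Ecoset UNIV T = Ecoset UNIV U"
  shows "Ecoset (gen_subring (range \<alpha>)) (map \<alpha> T) = Ecoset (gen_subring (range \<alpha>)) (map \<alpha> U)"
proof -
  have "Eseq (T @ inverse_word U) \<in> centreE UNIV"
    using assms UNIV.Ecoset_eq_iff by blast
  then have "Eseq (map \<alpha> T @ inverse_word (map \<alpha> U)) \<in> centreE (gen_subring (range \<alpha>))"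
    using jordan_maps_centreE by (fastforce simp: map_inverse_word)
  then show ?thesis
    using gen_subring.Ecoset_eq_iff[OF set_map_gen_subring set_map_gen_subring] by blast
qed

lemma jordan_Epoint_eq:
  assumes "Epoint T = Epoint U"
  shows "Epoint (map \<alpha> T) = Epoint (map \<alpha> U)"
proof -
  have "Epoint (map \<alpha> (T @ inverse_word U)) = pt (1, 0)"
    using assms by (intro jordan_fixes_base) (simp flip: Epoint_eq_iff)
  then show ?thesis
    by (simp add: Epoint_eq_iff[of "map \<alpha> T" "map \<alpha> U"] map_inverse_word)
qed

lemma jordan_induces_PE2_hom:
  "\<exists>f \<in> hom (PE2 UNIV) (PE2 (gen_subring (range \<alpha>))).
    \<forall>T. f (Ecoset UNIV T) = Ecoset (gen_subring (range \<alpha>)) (map \<alpha> T)"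
proof -
  let ?R'' = "gen_subring (range \<alpha>)"
  have "\<exists>f. (\<lambda>T. Ecoset ?R'' (map \<alpha> T)) = f \<circ> Ecoset UNIV"
    using jordan_Ecoset_eq by (subst function_factors_left[symmetric]) blast
  then obtain f where f_Ecoset: "f (Ecoset UNIV T) = Ecoset ?R'' (map \<alpha> T)" for T
    by (metis comp_apply)
  have "f \<in> hom (PE2 UNIV) (PE2 ?R'')"
  proof (rule homI)
    fix x assume "x \<in> carrier (PE2 (UNIV :: 'a set))"
    then show "f x \<in> carrier (PE2 ?R'')"
      using set_map_gen_subring by (fastforce simp: carrier_PE2 f_Ecoset)
  next
    fix x y assume "x \<in> carrier (PE2 (UNIV :: 'a set))" "y \<in> carrier (PE2 (UNIV :: 'a set))"
    then obtain T U where "x = Ecoset UNIV T" "y = Ecoset UNIV U"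
      by (auto simp: carrier_PE2)
    then show "f (x \<otimes>\<^bsub>PE2 UNIV\<^esub> y) = f x \<otimes>\<^bsub>PE2 ?R''\<^esub> f y"
      by (simp add: f_Ecoset UNIV.mult_PE2 gen_subring.mult_PE2 set_map_gen_subring
          del: set_map)
  qed
  with f_Ecoset show ?thesis
    by blast
qed

lemma jordan_induces_equivariant_map:
  "\<exists>\<phi> \<in> Corb UNIV \<rightarrow> Corb (gen_subring (range \<alpha>)).
    (\<forall>T. \<phi> (Epoint T) = Epoint (map \<alpha> T)) \<and>
    (\<forall>p \<in> Corb UNIV. \<forall>T. \<phi> (act p (Eseq T)) = act (\<phi> p) (Eseq (map \<alpha> T)))"
proof -
  have "\<exists>\<phi>. (\<lambda>T. Epoint (map \<alpha> T)) = \<phi> \<circ> Epoint"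
    using jordan_Epoint_eq by (subst function_factors_left[symmetric]) blast
  then obtain \<phi> where \<phi>_Epoint: "\<phi> (Epoint T) = Epoint (map \<alpha> T)" for T
    by (metis comp_apply)
  have "\<phi> \<in> Corb UNIV \<rightarrow> Corb (gen_subring (range \<alpha>))"
    using set_map_gen_subring by (fastforce simp: Corb_def \<phi>_Epoint)
  moreover have "\<phi> (act p (Eseq T)) = act (\<phi> p) (Eseq (map \<alpha> T))" if "p \<in> Corb UNIV" for p T
    using that by (auto simp: Corb_def act_Epoint \<phi>_Epoint)
  ultimately show ?thesis
    using \<phi>_Epoint by blast
qed

end

theorem theorem4p4:
  fixes \<alpha> :: "'a::ring_1 \<Rightarrow> 'b::ring_1"
  assumes "jordan_hom \<alpha>"
  defines "R'' \<equiv> gen_subring (range \<alpha>)"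
  shows "(\<exists>f. f \<in> hom (PE2 (UNIV :: 'a set)) (PE2 R'') \<and>
              (\<forall>T. f (centreE (UNIV :: 'a set) #>\<^bsub>E2grp (UNIV :: 'a set)\<^esub> Eseq T)
                    = centreE R'' #>\<^bsub>E2grp R''\<^esub> Eseq (map \<alpha> T)))
       \<and> (\<exists>\<phi>. \<phi> \<in> Corb (UNIV :: 'a set) \<rightarrow> Corb R'' \<and>
              (\<forall>T. \<phi> (act (pt (1, 0)) (Eseq T)) = act (pt (1, 0)) (Eseq (map \<alpha> T))) \<and>
              (\<forall>p \<in> Corb (UNIV :: 'a set). \<forall>T.
                  \<phi> (act p (Eseq T)) = act (\<phi> p) (Eseq (map \<alpha> T))))"
  unfolding R''_def
  using jordan_induces_PE2_hom[OF assms(1)] jordan_induces_equivariant_map[OF assms(1)] by blast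

end
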